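(* Let $W$ be a real $m\times n$ matrix with $m>n$ (over-complete) that is a tight frame, $W^TW=I$, and whose rows are partitioned (after a reordering of rows) into $K$ blocks $B_1,\dots,B_K$. Let $(\mathbf{x},\mathbf{y})$ be a random pair in $\mathbb{R}^n\times\mathbb{R}^n$, and let $\Psi$ be a given set of measurable functions $\mathbb{R}\to\mathbb{R}$. For $\psi=(\psi_1,\dots,\psi_K)$ with each $\psi_k\in\Psi$, put $$\mathbf{d}_k=B_k\mathbf{x}-\psi_k(B_k\mathbf{y}),\qquad \mathbf{d}_k^{\mathcal S}=B_k^T\mathbf{d}_k,$$ where $\psi_k$ is applied entrywise, and $$\Delta_1(\psi)=\sum_{k}\sqrt{E\|\mathbf{d}_k\|^2},\qquad \Delta_2(\psi)=\sum_{k}\sqrt{E\|\mathbf{d}_k^{\mathcal S}\|^2},\qquad \Delta_3(\psi)=\sqrt{E\Big\|\sum_{k}\mathbf{d}_k^{\mathcal S}\Big\|^2}.$$ For $i=1,2,3$ let $\hat\psi^i\in\arg\min_{\psi}\Delta_i(\psi)$, the minimum being over all $\psi=(\psi_1,\dots,\psi_K)$ with $\psi_k\in\Psi$ for every $k$. Then $$\Delta_1(\hat\psi^1)\ \ge\ \Delta_2(\hat\psi^2)\ \ge\ \Delta_3(\hat\psi^3).$$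
   Context: $\|\cdot\|$ is the Euclidean norm and expectations are over the joint distribution of $(\mathbf{x},\mathbf{y})$ (values in $[0,\infty]$). $\mathbf{x}$ is a clean image, $\mathbf{y}$ a noisy image, the blocks $B_k$ are the wavelet bands of the transform, and $\psi_k$ is the scalar shrinkage function applied to every coefficient of band $k$. $\Delta_1$ is the band-by-band transform-domain objective, $\Delta_2$ the band-by-band spatial-domain objective, and $\Delta_3$ the joint spatial-domain objective. *)

theory Defs
  imports "HOL-Probability.Probability"
begin

definition tight_frame :: "real ^ 'n ^ 'm \<Rightarrow> bool" where
  "tight_frame W \<longleftrightarrow> transpose W ** W = mat 1"

definition ennsqrt :: "ennreal \<Rightarrow> ennreal" where
  "ennsqrt a = (if a = \<infinity> then \<infinity> else ennreal (sqrt (enn2real a)))"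

(* A block of rows is given by its set R of row indices.  Block matrices and block vectors keep
   the index type of the full matrix and are zero on the rows outside R, so that blocks of
   different heights have the same type.  The padding changes neither the Euclidean norm of a
   block vector nor its product with the transposed block. *)

definition row_block :: "real ^ 'n ^ 'm \<Rightarrow> 'm set \<Rightarrow> real ^ 'n ^ 'm" where
  "row_block W R = (\<chi> i. if i \<in> R then W $ i else 0)"

(* The padding is imposed after applying f, since f 0 need not be 0. *)
definition band_error ::
  "real ^ 'n ^ 'm \<Rightarrow> 'm set \<Rightarrow> (real \<Rightarrow> real) \<Rightarrow> real ^ 'n \<Rightarrow> real ^ 'n \<Rightarrow> real ^ 'm" where
  "band_error W R f x y =
     (\<chi> i. if i \<in> R then (row_block W R *v x) $ i - f ((row_block W R *v y) $ i) else 0)"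

definition spatial_band_error ::
  "real ^ 'n ^ 'm \<Rightarrow> 'm set \<Rightarrow> (real \<Rightarrow> real) \<Rightarrow> real ^ 'n \<Rightarrow> real ^ 'n \<Rightarrow> real ^ 'n" where
  "spatial_band_error W R f x y = transpose (row_block W R) *v band_error W R f x y"

lemma norm_band_error:
  "norm (band_error W R f x y) = L2_set (\<lambda>i. (W *v x) $ i - f ((W *v y) $ i)) R"
proof -
  have "norm (band_error W R f x y) =
      L2_set (\<lambda>i. if i \<in> R then (W *v x) $ i - f ((W *v y) $ i) else 0) UNIV"
    unfolding norm_vec_def L2_set_def
    by (rule arg_cong[where f = sqrt], rule sum.cong)
      (auto simp: band_error_def row_block_def matrix_vector_mult_def)
  also have "\<dots> = L2_set (\<lambda>i. (W *v x) $ i - f ((W *v y) $ i)) R"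
    unfolding L2_set_def
    by (rule arg_cong[where f = sqrt], rule sum.mono_neutral_cong_right) auto
  finally show ?thesis .
qed

definition Delta1 ::
  "'w measure \<Rightarrow> ('w \<Rightarrow> real ^ 'n) \<Rightarrow> ('w \<Rightarrow> real ^ 'n) \<Rightarrow> real ^ 'n ^ 'm \<Rightarrow>
   nat \<Rightarrow> (nat \<Rightarrow> 'm set) \<Rightarrow> (nat \<Rightarrow> real \<Rightarrow> real) \<Rightarrow> ennreal" where
  "Delta1 M x y W K blk \<psi> =
     (\<Sum>k=1..K. ennsqrt (\<integral>\<^sup>+\<omega>. ennreal ((norm (band_error W (blk k) (\<psi> k) (x \<omega>) (y \<omega>)))\<^sup>2) \<partial>M))"

definition Delta2 ::
  "'w measure \<Rightarrow> ('w \<Rightarrow> real ^ 'n) \<Rightarrow> ('w \<Rightarrow> real ^ 'n) \<Rightarrow> real ^ 'n ^ 'm \<Rightarrow>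
   nat \<Rightarrow> (nat \<Rightarrow> 'm set) \<Rightarrow> (nat \<Rightarrow> real \<Rightarrow> real) \<Rightarrow> ennreal" where
  "Delta2 M x y W K blk \<psi> =
     (\<Sum>k=1..K. ennsqrt (\<integral>\<^sup>+\<omega>. ennreal ((norm (spatial_band_error W (blk k) (\<psi> k) (x \<omega>) (y \<omega>)))\<^sup>2) \<partial>M))"

definition Delta3 ::
  "'w measure \<Rightarrow> ('w \<Rightarrow> real ^ 'n) \<Rightarrow> ('w \<Rightarrow> real ^ 'n) \<Rightarrow> real ^ 'n ^ 'm \<Rightarrow>
   nat \<Rightarrow> (nat \<Rightarrow> 'm set) \<Rightarrow> (nat \<Rightarrow> real \<Rightarrow> real) \<Rightarrow> ennreal" where
  "Delta3 M x y W K blk \<psi> =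
     ennsqrt (\<integral>\<^sup>+\<omega>. ennreal ((norm (\<Sum>k=1..K. spatial_band_error W (blk k) (\<psi> k) (x \<omega>) (y \<omega>)))\<^sup>2) \<partial>M)"

end

theory Submission
  imports Defs
begin

text \<open>
  Both inequalities hold for every fixed \<open>\<psi>\<close> and pass to the minima. Tightness makes \<open>W\<close> an
  isometry, so \<open>W\<^sup>T\<close> is a contraction; since each \<open>\<^bold>d\<^sub>k\<close> vanishes outside its block,
  \<open>B\<^sub>k\<^sup>T \<^bold>d\<^sub>k = W\<^sup>T \<^bold>d\<^sub>k\<close>, which gives \<open>\<Delta>\<^sub>2 \<le> \<Delta>\<^sub>1\<close>. The inequality \<open>\<Delta>\<^sub>3 \<le> \<Delta>\<^sub>2\<close> is Minkowski's inequality in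
  \<open>L\<^sup>2\<close>, valid also when some of the expectations are infinite.
\<close>

lemma ennsqrt_mono: "a \<le> b \<Longrightarrow> ennsqrt a \<le> ennsqrt b"
  by (auto simp: ennsqrt_def top_unique enn2real_mono less_top intro!: ennreal_leI)

lemma ennsqrt_power2 [simp]: "(ennsqrt a)\<^sup>2 = a"
  by (cases a) (auto simp: ennsqrt_def ennreal_power)

lemma ennsqrt_of_power2 [simp]: "ennsqrt (a\<^sup>2) = a"
  by (cases a) (auto simp: ennsqrt_def ennreal_power)

text \<open>\<open>ennsqrt\<close> is a two-sided inverse of squaring on \<open>ennreal\<close>, so
  it inherits multiplicativity from squaring, infinite values included.\<close>

lemma ennsqrt_mult: "ennsqrt (a * b) = ennsqrt a * ennsqrt b"
  by (metis ennsqrt_of_power2 ennsqrt_power2 power_mult_distrib)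

text \<open>Expand the square and bound the cross term by Cauchy-Schwarz. Nothing is subtracted or
  divided, so infinite integrals need no separate case.\<close>

lemma Minkowski_nn_integral:
  fixes f g :: "'a \<Rightarrow> ennreal"
  assumes [measurable]: "f \<in> borel_measurable M" "g \<in> borel_measurable M"
  shows "ennsqrt (\<integral>\<^sup>+w. (f w + g w)\<^sup>2 \<partial>M)
    \<le> ennsqrt (\<integral>\<^sup>+w. (f w)\<^sup>2 \<partial>M) + ennsqrt (\<integral>\<^sup>+w. (g w)\<^sup>2 \<partial>M)"
proof -
  let ?A = "\<integral>\<^sup>+w. (f w)\<^sup>2 \<partial>M" and ?B = "\<integral>\<^sup>+w. (g w)\<^sup>2 \<partial>M" and ?C = "\<integral>\<^sup>+w. f w * g w \<partial>M"
  have C: "?C \<le> ennsqrt ?A * ennsqrt ?B"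
    using ennsqrt_mono[OF Cauchy_Schwarz_nn_integral[OF assms]] by (simp add: ennsqrt_mult)
  have "(\<integral>\<^sup>+w. (f w + g w)\<^sup>2 \<partial>M) = (\<integral>\<^sup>+w. (f w)\<^sup>2 + (g w)\<^sup>2 + 2 * (f w * g w) \<partial>M)"
    by (simp add: power2_sum mult.assoc)
  also have "\<dots> = ?A + ?B + 2 * ?C"
    by (simp add: nn_integral_add nn_integral_cmult)
  also have "\<dots> \<le> ?A + ?B + 2 * (ennsqrt ?A * ennsqrt ?B)"
    by (intro add_left_mono mult_left_mono C) simp
  \<comment> \<open>With \<open>?A\<close> and \<open>?B\<close> read as squares of their roots, the
    bound is a perfect square.\<close>
  also have "\<dots> = (ennsqrt ?A + ennsqrt ?B)\<^sup>2"
    by (simp add: power2_sum mult.assoc)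
  finally have "ennsqrt (\<integral>\<^sup>+w. (f w + g w)\<^sup>2 \<partial>M) \<le> ennsqrt ((ennsqrt ?A + ennsqrt ?B)\<^sup>2)"
    by (rule ennsqrt_mono)
  then show ?thesis by simp
qed

lemma ennsqrt_nn_integral_norm_sum_le:
  fixes f :: "'i \<Rightarrow> 'a \<Rightarrow> 'b::{second_countable_topology, real_normed_vector}"
  assumes "finite I" and "\<And>i. i \<in> I \<Longrightarrow> f i \<in> borel_measurable M"
  shows "ennsqrt (\<integral>\<^sup>+w. ennreal ((norm (\<Sum>i\<in>I. f i w))\<^sup>2) \<partial>M)
    \<le> (\<Sum>i\<in>I. ennsqrt (\<integral>\<^sup>+w. ennreal ((norm (f i w))\<^sup>2) \<partial>M))"
  using assms
proof (induction I rule: finite_induct)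
  case empty
  then show ?case by (simp add: ennsqrt_def)
next
  case (insert j I)
  let ?S = "\<lambda>w. \<Sum>i\<in>I. f i w"
  have [measurable]: "f j \<in> borel_measurable M" "?S \<in> borel_measurable M"
    using insert.prems by auto
  \<comment> \<open>The pointwise triangle inequality replaces vectors by their norms, leaving
    scalar functions to which Minkowski's inequality applies.\<close>
  have "ennsqrt (\<integral>\<^sup>+w. ennreal ((norm (\<Sum>i\<in>insert j I. f i w))\<^sup>2) \<partial>M)
      \<le> ennsqrt (\<integral>\<^sup>+w. (ennreal (norm (f j w)) + ennreal (norm (?S w)))\<^sup>2 \<partial>M)"
    using insert.hyps
    by (intro ennsqrt_mono nn_integral_mono)
      (auto simp: ennreal_power norm_triangle_ineq simp flip: ennreal_plus
        intro!: ennreal_leI power_mono)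
  also have "\<dots> \<le> ennsqrt (\<integral>\<^sup>+w. (ennreal (norm (f j w)))\<^sup>2 \<partial>M)
      + ennsqrt (\<integral>\<^sup>+w. (ennreal (norm (?S w)))\<^sup>2 \<partial>M)"
    by (rule Minkowski_nn_integral) measurable
  also have "\<dots> \<le> (\<Sum>i\<in>insert j I. ennsqrt (\<integral>\<^sup>+w. ennreal ((norm (f i w))\<^sup>2) \<partial>M))"
    using insert by (auto simp: ennreal_power intro: add_left_mono)
  finally show ?case .
qed

lemma tight_frame_norm:
  assumes "tight_frame W"
  shows "norm (W *v u) = norm u"
proof -
  have "(W *v u) \<bullet> (W *v u) = ((transpose W ** W) *v u) \<bullet> u"
    by (metis dot_lmul_matrix matrix_vector_mul_assoc transpose_matrix_vector)
  also have "\<dots> = u \<bullet> u"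
    using assms by (simp add: tight_frame_def)
  finally show ?thesis
    by (simp add: norm_eq_sqrt_inner)
qed

text \<open>For v = W^T d, moving W^T across the inner product gives |v|^2 = d . Wv \<le> |d| |Wv| =
  |d| |v|; cancel |v| unless it is zero.\<close>

lemma norm_transpose_tight_frame_le:
  assumes "tight_frame W"
  shows "norm (transpose W *v d) \<le> norm d"
proof -
  let ?v = "transpose W *v d"
  have "norm ?v * norm ?v = d \<bullet> (W *v ?v)"
    by (metis dot_lmul_matrix power2_eq_square power2_norm_eq_inner
        transpose_matrix_vector)
  also have "\<dots> \<le> norm d * norm ?v"
    using norm_cauchy_schwarz[of d "W *v ?v"] by (simp add: tight_frame_norm[OF assms])
  finally show ?thesis
    by (cases "norm ?v = 0") auto
qed

lemma spatial_band_error_eq: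
  "spatial_band_error W R f x y = transpose W *v band_error W R f x y"
  by (auto simp: spatial_band_error_def band_error_def row_block_def transpose_def
      matrix_vector_mult_def vec_eq_iff intro!: sum.cong)

lemma norm_spatial_band_error_le:
  "tight_frame W \<Longrightarrow> norm (spatial_band_error W R f x y) \<le> norm (band_error W R f x y)"
  unfolding spatial_band_error_eq by (rule norm_transpose_tight_frame_le)

lemma borel_measurable_matrix_vector_mult [measurable]:
  fixes A :: "real ^ 'n ^ 'm"
  assumes "x \<in> borel_measurable M"
  shows "(\<lambda>w. A *v x w) \<in> borel_measurable M"
  by (rule borel_measurable_continuous_on[OF _ assms])
    (intro linear_continuous_on matrix_vector_mul_bounded_linear)

lemma borel_measurable_vec_nth [measurable]:
  fixes x :: "'a \<Rightarrow> real ^ 'n"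
  assumes "x \<in> borel_measurable M"
  shows "(\<lambda>w. x w $ i) \<in> borel_measurable M"
  by (rule borel_measurable_continuous_on[OF _ assms]) (intro continuous_intros)

lemma borel_measurable_spatial_band_error:
  fixes W :: "real ^ 'n ^ 'm"
  assumes [measurable]: "f \<in> borel_measurable borel" "x \<in> borel_measurable M" "y \<in> borel_measurable M"
  shows "(\<lambda>w. spatial_band_error W R f (x w) (y w)) \<in> borel_measurable M"
proof -
  \<comment> \<open>Measurability is checked by coordinates: inside \<open>R\<close> a coordinate is
    built from \<open>f\<close> and linear maps, outside it is constantly 0.\<close>
  have "(\<lambda>w. band_error W R f (x w) (y w) $ i) \<in> borel_measurable M" for i
    unfolding band_error_def by (cases "i \<in> R") simp_all
  then have "(\<lambda>w. band_error W R f (x w) (y w)) \<in> borel_measurable M"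
    by (subst borel_measurable_euclidean_space) (auto simp: Basis_vec_def inner_axis)
  then show ?thesis
    unfolding spatial_band_error_eq by (rule borel_measurable_matrix_vector_mult)
qed

lemma Delta2_le_Delta1:
  assumes "tight_frame W"
  shows "Delta2 M x y W K blk \<psi> \<le> Delta1 M x y W K blk \<psi>"
  unfolding Delta1_def Delta2_def
  by (intro sum_mono ennsqrt_mono nn_integral_mono ennreal_leI power_mono
      norm_spatial_band_error_le assms norm_ge_zero)

lemma Delta3_le_Delta2:
  assumes "x \<in> borel_measurable M" "y \<in> borel_measurable M"
    and "\<And>k. k \<in> {1..K} \<Longrightarrow> \<psi> k \<in> borel_measurable borel"
  shows "Delta3 M x y W K blk \<psi> \<le> Delta2 M x y W K blk \<psi>"
  unfolding Delta2_def Delta3_def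
  by (intro ennsqrt_nn_integral_norm_sum_le borel_measurable_spatial_band_error assms finite_atLeastAtMost)

text \<open>The chain is f a \<le> f b \<le> g b, where the first step uses that \<open>b\<close> is
  feasible. The objectives need comparing only at \<open>b\<close>, the minimizer of the larger
  one.\<close>

lemma is_arg_min_value_mono:
  fixes f g :: "'a \<Rightarrow> 'b::linorder"
  assumes "is_arg_min f P a" "is_arg_min g P b" "f b \<le> g b"
  shows "f a \<le> g b"
  using assms by (force simp: is_arg_min_linorder)

theorem theorem5:
  fixes W :: "real ^ 'n ^ 'm"
    and K :: nat
    and blk :: "nat \<Rightarrow> 'm set"
    and M :: "'w measure"
    and x y :: "'w \<Rightarrow> real ^ 'n"
    and \<Psi> :: "(real \<Rightarrow> real) set"
    and \<psi>1 \<psi>2 \<psi>3 :: "nat \<Rightarrow> real \<Rightarrow> real"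
  assumes "CARD('m) > CARD('n)"
    and "tight_frame W"
    and "partition_on UNIV (blk ` {1..K})" and "inj_on blk {1..K}"
    and "prob_space M"
    and "x \<in> borel_measurable M" and "y \<in> borel_measurable M"
    and "\<Psi> \<subseteq> borel_measurable borel"
    and "is_arg_min (Delta1 M x y W K blk) (\<lambda>\<psi>. \<psi> \<in> {1..K} \<rightarrow>\<^sub>E \<Psi>) \<psi>1"
    and "is_arg_min (Delta2 M x y W K blk) (\<lambda>\<psi>. \<psi> \<in> {1..K} \<rightarrow>\<^sub>E \<Psi>) \<psi>2"
    and "is_arg_min (Delta3 M x y W K blk) (\<lambda>\<psi>. \<psi> \<in> {1..K} \<rightarrow>\<^sub>E \<Psi>) \<psi>3"
  shows "Delta1 M x y W K blk \<psi>1 \<ge> Delta2 M x y W K blk \<psi>2 \<and>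
    Delta2 M x y W K blk \<psi>2 \<ge> Delta3 M x y W K blk \<psi>3"
proof
  show "Delta1 M x y W K blk \<psi>1 \<ge> Delta2 M x y W K blk \<psi>2"
    by (rule is_arg_min_value_mono[OF assms(10,9) Delta2_le_Delta1[OF assms(2)]])
  \<comment> \<open>Minkowski's inequality needs measurable errors; feasibility of
    \<open>\<psi>2\<close> places its components in \<open>\<Psi>\<close>, a set of measurable
    functions.\<close>
  have "\<psi>2 k \<in> borel_measurable borel" if "k \<in> {1..K}" for k
    using assms(8,10) that by (auto simp: is_arg_min_def)
  then show "Delta2 M x y W K blk \<psi>2 \<ge> Delta3 M x y W K blk \<psi>3"
    by (intro is_arg_min_value_mono[OF assms(11,10)] Delta3_le_Delta2 assms(6,7))
qed

end
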